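(* Let $\alpha\in(0,1]$ and $\tilde\Omega:=[a-b,b-a]$. Assume that: (a) $\tilde f(\cdot,z):\tilde\Omega\to\mathbb R^d$ is measurable for all $z\in Z$, and for every $r>0$ there is an integrable function $\tilde b_r:\tilde\Omega\to\mathbb R_+$ such that for Lebesgue-almost all $y\in\tilde\Omega$ one has $|\tilde f(y,z)|\le\tilde b_r(y)$ for all $z\in Z\cap\bar B_r(0)$; (b) for every $r>0$ there is an integrable function $\tilde l_r:\tilde\Omega\to\mathbb R_+$ such that for Lebesgue-almost all $y\in\tilde\Omega$ one has $|\tilde f(y,z)-\tilde f(y,\bar z)|\le\tilde l_r(y)|z-\bar z|$ for all $z,\bar z\in Z\cap\bar B_r(0)$; (c) $\tilde f$ and its partial derivative $D_1\tilde f$ exist as continuous functions on both sets $[a-b,0)\times Z$ and $(0,b-a]\times Z$. If $u\in U_\alpha$, $r>\|u\|_0$ and there exists $h_0>0$ such that $\int_{-h_0}^{h_0}\tilde l_r(y)\,dy<\infty$, then the function $\tilde{\mathscr U}(u):[a,b]\to\mathbb R^d$, $\tilde{\mathscr U}(u)(x):=\int_a^b\tilde f(x-y,u(y))\,dy$, is $\alpha$-Hölder on every compact subinterval of $(a,b)$.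
   Context: $a<b$ are reals, $Z\subseteq\mathbb R^n$ is nonempty, $\tilde f:[a-b,b-a]\times Z\to\mathbb R^d$ is a function, and measurability/integrability refer to one-dimensional Lebesgue measure. $\mathbb R_+=[0,\infty)$, $|\cdot|$ denotes norms on finite-dimensional spaces, $\bar B_r(0)=\{z\in\mathbb R^n:|z|\le r\}$, $\|u\|_0=\sup_{x\in[a,b]}|u(x)|$. A function $u:I\to\mathbb R^m$ on an interval $I$ is $\alpha$-Hölder if $[u]_\alpha:=\sup_{x\ne\bar x}|u(x)-u(\bar x)|/|x-\bar x|^\alpha<\infty$; $U_\alpha$ is the set of all $\alpha$-Hölder functions $u:[a,b]\to\mathbb R^n$ with values in $Z$. *)

theory Defs
  imports "HOL-Analysis.Analysis"
begin

text \<open>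
  Norms on finite-dimensional spaces are arbitrary, not necessarily the Euclidean \<^const>\<open>norm\<close>,
  so they are passed as parameters. Topology, measurability and integrals of
  vector-valued functions refer to the standard structure of \<open>real ^ 'n\<close>, on which they do not
  depend on the choice of a norm.
\<close>

definition is_norm :: "('v::real_vector \<Rightarrow> real) \<Rightarrow> bool" where
  "is_norm N \<longleftrightarrow>
     (\<forall>x. 0 \<le> N x) \<and> (\<forall>x. N x = 0 \<longleftrightarrow> x = 0) \<and>
     (\<forall>c x. N (c *\<^sub>R x) = \<bar>c\<bar> * N x) \<and> (\<forall>x y. N (x + y) \<le> N x + N y)"

text \<open>The set is that of the Hoelder quotients; it is bounded iff its supremum
  $[u]_\alpha$ is finite.\<close>

definition holder_on :: "('v::real_vector \<Rightarrow> real) \<Rightarrow> real \<Rightarrow> real set \<Rightarrow> (real \<Rightarrow> 'v) \<Rightarrow> bool" where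
  "holder_on N \<alpha> I u \<longleftrightarrow>
     bdd_above {N (u x - u x') / \<bar>x - x'\<bar> powr \<alpha> | x x'. x \<in> I \<and> x' \<in> I \<and> x \<noteq> x'}"

text \<open>Functions on \<open>[a, b]\<close> are total functions whose values outside \<open>[a, b]\<close> are irrelevant.\<close>

definition holder_class ::
  "('v::real_vector \<Rightarrow> real) \<Rightarrow> real \<Rightarrow> real \<Rightarrow> real \<Rightarrow> 'v set \<Rightarrow> (real \<Rightarrow> 'v) set" where
  "holder_class N \<alpha> a b Z = {u. holder_on N \<alpha> {a..b} u \<and> (\<forall>x\<in>{a..b}. u x \<in> Z)}"

definition sup_norm :: "('v \<Rightarrow> real) \<Rightarrow> real \<Rightarrow> real \<Rightarrow> (real \<Rightarrow> 'v) \<Rightarrow> real" where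
  "sup_norm N a b u = (SUP x\<in>{a..b}. N (u x))"

definition norm_cball :: "('v \<Rightarrow> real) \<Rightarrow> real \<Rightarrow> 'v set" where
  "norm_cball N r = {z. N z \<le> r}"

text \<open>The function and its partial derivative in the first variable are jointly continuous on
  \<open>S \<times> Z\<close>. The derivative is taken within \<open>S\<close>, hence one-sided at an endpoint of an
  interval \<open>S\<close>.\<close>

definition C1_fst_on ::
  "real set \<Rightarrow> 'v::topological_space set \<Rightarrow> (real \<Rightarrow> 'v \<Rightarrow> 'w::real_normed_vector) \<Rightarrow> bool" where
  "C1_fst_on S Z f \<longleftrightarrow>
     continuous_on (S \<times> Z) (\<lambda>(y, z). f y z) \<and>
     (\<exists>D. (\<forall>y\<in>S. \<forall>z\<in>Z. ((\<lambda>t. f t z) has_vector_derivative D y z) (at y within S)) \<and>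
          continuous_on (S \<times> Z) (\<lambda>(y, z). D y z))"

definition conv_urysohn ::
  "real \<Rightarrow> real \<Rightarrow> (real \<Rightarrow> 'v \<Rightarrow> 'w::{banach, second_countable_topology}) \<Rightarrow> (real \<Rightarrow> 'v) \<Rightarrow> real \<Rightarrow> 'w"
  where
  "conv_urysohn a b f u x = (\<integral>y. f (x - y) (u y) \<partial>lebesgue_on {a..b})"

end

theory Submission
  imports Defs
begin

text \<open>
  The idea is to move the dependence on \<open>x\<close> from the singular argument of \<open>f\<close> into \<open>u\<close>. The
  substitution \<open>s = x - y\<close> turns \<open>F = conv_urysohn a b f u\<close> into the integral of \<open>f(s, u(x-s))\<close>
  over \<open>s \<in> [x-b, x-a]\<close> (\<open>conv_urysohn_eq_integral_diff\<close>). Let \<open>x < x'\<close> lie in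
  \<open>[c, d]\<close> with \<open>a < c\<close> and \<open>d < b\<close>. The increment \<open>F(x') - F(x)\<close> collects contributions of
  two kinds (\<open>conv_urysohn_increment\<close>).

  Where both integrands live, the singularity \<open>s = 0\<close> included, the first argument of \<open>f\<close> is the
  same in both, so the Lipschitz condition bounds the difference by
  \<open>L(s) |u(x'-s) - u(x-s)|\<close>, hence by \<open>B L(s) |x'-x| powr \<alpha>\<close> with \<open>B\<close> a Hoelder constant of \<open>u\<close>.
  Integrability of \<open>L\<close> makes this a multiple of \<open>|x'-x| powr \<alpha>\<close>.

  The rest are the two edges \<open>[x-b, x'-b]\<close> and \<open>[x-a, x'-a]\<close>, of length \<open>x'-x\<close>. They lie in
  \<open>[a-b, d-b]\<close> and \<open>[c-a, b-a]\<close>, away from the singularity; there \<open>f\<close> is bounded on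
  the compact range of \<open>u\<close> by continuity, so the edges contribute a multiple of \<open>|x'-x|\<close>. On a
  bounded interval this is again dominated by \<open>|x'-x| powr \<alpha>\<close>, as \<open>\<alpha> \<le> 1\<close>.

  Integrability comes from continuity of \<open>s \<mapsto> f(s, u(x-s))\<close> off the point \<open>s = 0\<close>, which
  makes this function Borel, and from the integrable bound on \<open>f\<close>. All norms on a
  finite-dimensional space being equivalent, everything is proved for the Euclidean norm first.
\<close>

section \<open>Norms and Hoelder conditions\<close>

lemma is_norm_le_norm:
  fixes N :: "'v::euclidean_space \<Rightarrow> real"
  assumes "is_norm N"
  obtains C where "0 < C" "\<And>x. N x \<le> C * norm x"
proof -
  have tri: "N (x + y) \<le> N x + N y" and hom: "N (c *\<^sub>R x) = \<bar>c\<bar> * N x"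
    and nonneg: "0 \<le> N x" for x y c
    using assms by (auto simp: is_norm_def)
  have sum_le: "N (\<Sum>i\<in>A. g i) \<le> (\<Sum>i\<in>A. N (g i))" if "finite A" for A and g :: "'v \<Rightarrow> 'v"
    using that
  proof induction
    case empty
    then show ?case using hom[of 0 0] by simp
  next
    case (insert i A)
    then show ?case using tri[of "g i" "sum g A"] by simp
  qed
  have "N x \<le> (1 + (\<Sum>i\<in>Basis. N i)) * norm x" for x
  proof -
    have "N x = N (\<Sum>i\<in>Basis. (x \<bullet> i) *\<^sub>R i)" by (simp add: euclidean_representation)
    also have "\<dots> \<le> (\<Sum>i\<in>Basis. \<bar>x \<bullet> i\<bar> * N i)"
      using sum_le[of Basis "\<lambda>i. (x \<bullet> i) *\<^sub>R i"] by (simp add: hom)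
    also have "\<dots> \<le> (\<Sum>i\<in>Basis. norm x * N i)"
      by (intro sum_mono mult_right_mono Basis_le_norm nonneg)
    also have "\<dots> \<le> (1 + (\<Sum>i\<in>Basis. N i)) * norm x"
      by (simp add: algebra_simps sum_distrib_left)
    finally show ?thesis .
  qed
  moreover have "0 < 1 + (\<Sum>i\<in>Basis. N i)"
    by (intro add_pos_nonneg sum_nonneg nonneg) simp
  ultimately show ?thesis using that by blast
qed

lemma is_norm_continuous_on:
  fixes N :: "'v::euclidean_space \<Rightarrow> real"
  assumes "is_norm N"
  shows "continuous_on S N"
proof -
  obtain C where C: "0 < C" "\<And>x. N x \<le> C * norm x"
    using is_norm_le_norm[OF assms] by metis
  have tri: "N (x + y) \<le> N x + N y" for x y
    using assms by (auto simp: is_norm_def)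
  have "N x - N y \<le> C * norm (x - y)" for x y
    using tri[of "x - y" y] C(2)[of "x - y"] by simp
  then have "dist (N x) (N y) \<le> C * dist x y" for x y
    by (smt (verit) dist_norm norm_minus_commute real_norm_def)
  then have "C-lipschitz_on S N"
    using C(1) by (intro lipschitz_onI) auto
  then show ?thesis by (rule lipschitz_on_continuous_on)
qed

text \<open>The constant is the reciprocal of the minimum of \<open>N\<close> on the compact unit sphere.\<close>

lemma norm_le_is_norm:
  fixes N :: "'v::euclidean_space \<Rightarrow> real"
  assumes "is_norm N"
  obtains C where "0 < C" "\<And>x. norm x \<le> C * N x"
proof -
  have hom: "N (c *\<^sub>R x) = \<bar>c\<bar> * N x" and nonneg: "0 \<le> N x" and zero: "N x = 0 \<longleftrightarrow> x = 0" for x c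
    using assms by (auto simp: is_norm_def)
  obtain e :: 'v where "e \<in> sphere 0 1" using norm_Basis by (metis mem_sphere_0 nonempty_Basis ex_in_conv)
  then obtain p where p: "p \<in> sphere 0 1" "\<And>y. y \<in> sphere 0 1 \<Longrightarrow> N p \<le> N y"
    using continuous_attains_inf[OF compact_sphere _ is_norm_continuous_on[OF assms], of 0 1] by blast
  then have pos: "0 < N p" using zero[of p] nonneg[of p] by force
  have "norm x \<le> (1 / N p) * N x" for x
  proof (cases "x = 0")
    case True
    then show ?thesis using zero[of x] by simp
  next
    case False
    then have "N p \<le> N ((1 / norm x) *\<^sub>R x)" by (intro p(2)) simp
    also have "\<dots> = N x / norm x" by (simp add: hom)
    finally show ?thesis using pos False by (simp add: field_simps)
  qed
  then show ?thesis using pos that[of "1 / N p"] by simp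
qed

text \<open>The multiplied-out form also covers \<open>x = x'\<close>, because \<open>0 powr \<alpha> = 0\<close>.\<close>

lemma holder_on_iff:
  assumes "is_norm N" "0 < \<alpha>"
  shows "holder_on N \<alpha> I u \<longleftrightarrow>
    (\<exists>B\<ge>0. \<forall>x\<in>I. \<forall>x'\<in>I. N (u x - u x') \<le> B * \<bar>x - x'\<bar> powr \<alpha>)"
proof
  assume "holder_on N \<alpha> I u"
  then obtain B where B: "\<And>x x'. x \<in> I \<Longrightarrow> x' \<in> I \<Longrightarrow> x \<noteq> x' \<Longrightarrow>
      N (u x - u x') / \<bar>x - x'\<bar> powr \<alpha> \<le> B"
    unfolding holder_on_def bdd_above_def by blast
  have "N (u x - u x') \<le> max 0 B * \<bar>x - x'\<bar> powr \<alpha>" if "x \<in> I" "x' \<in> I" for x x'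
  proof (cases "x = x'")
    case True
    have "N 0 = 0" using assms(1) by (simp add: is_norm_def)
    with True show ?thesis by simp
  next
    case False
    then have "N (u x - u x') \<le> B * \<bar>x - x'\<bar> powr \<alpha>"
      using B[OF that False] by (simp add: field_simps)
    also have "\<dots> \<le> max 0 B * \<bar>x - x'\<bar> powr \<alpha>" by (intro mult_right_mono) auto
    finally show ?thesis .
  qed
  then show "\<exists>B\<ge>0. \<forall>x\<in>I. \<forall>x'\<in>I. N (u x - u x') \<le> B * \<bar>x - x'\<bar> powr \<alpha>"
    by (intro exI[of _ "max 0 B"]) auto
next
  assume "\<exists>B\<ge>0. \<forall>x\<in>I. \<forall>x'\<in>I. N (u x - u x') \<le> B * \<bar>x - x'\<bar> powr \<alpha>"
  then obtain B where "\<And>x x'. x \<in> I \<Longrightarrow> x' \<in> I \<Longrightarrow> N (u x - u x') \<le> B * \<bar>x - x'\<bar> powr \<alpha>"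
    by blast
  then show "holder_on N \<alpha> I u"
    unfolding holder_on_def bdd_above_def by (intro exI[of _ B]) (auto simp: field_simps)
qed

lemma is_norm_norm: "is_norm norm"
  by (auto simp: is_norm_def norm_triangle_ineq)

lemma holder_on_norm_cong:
  fixes N :: "'v::euclidean_space \<Rightarrow> real"
  assumes "is_norm N" "0 < \<alpha>"
  shows "holder_on N \<alpha> I u \<longleftrightarrow> holder_on norm \<alpha> I u"
proof -
  obtain C1 where C1: "0 < C1" "\<And>x. N x \<le> C1 * norm x"
    using is_norm_le_norm[OF assms(1)] by metis
  obtain C2 where C2: "0 < C2" "\<And>x. norm x \<le> C2 * N x"
    using norm_le_is_norm[OF assms(1)] by metis
  have dominated: "\<exists>B\<ge>0. \<forall>x\<in>I. \<forall>x'\<in>I. P (u x - u x') \<le> B * \<bar>x - x'\<bar> powr \<alpha>"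
    if "0 < C" "\<And>x. P x \<le> C * Q x"
      "\<exists>B\<ge>0. \<forall>x\<in>I. \<forall>x'\<in>I. Q (u x - u x') \<le> B * \<bar>x - x'\<bar> powr \<alpha>"
    for P Q :: "'v \<Rightarrow> real" and C
  proof -
    from that(3) obtain B where B: "0 \<le> B"
      "\<And>x x'. x \<in> I \<Longrightarrow> x' \<in> I \<Longrightarrow> Q (u x - u x') \<le> B * \<bar>x - x'\<bar> powr \<alpha>" by blast
    have "P (u x - u x') \<le> (C * B) * \<bar>x - x'\<bar> powr \<alpha>" if "x \<in> I" "x' \<in> I" for x x'
      using order_trans[OF \<open>\<And>x. P x \<le> C * Q x\<close> mult_left_mono[OF B(2)[OF that]]] \<open>0 < C\<close>
      by (simp add: mult.assoc)
    then show ?thesis using B(1) \<open>0 < C\<close> by (intro exI[of _ "C * B"]) auto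
  qed
  show ?thesis
    unfolding holder_on_iff[OF assms] holder_on_iff[OF is_norm_norm assms(2)]
    by (rule iffI, erule dominated[OF C2], erule dominated[OF C1])
qed

lemma holder_on_imp_continuous_on:
  fixes u :: "real \<Rightarrow> 'v::real_normed_vector"
  assumes "holder_on norm \<alpha> I u" "0 < \<alpha>"
  shows "continuous_on I u"
proof -
  obtain B where B: "\<And>x x'. x \<in> I \<Longrightarrow> x' \<in> I \<Longrightarrow> norm (u x - u x') \<le> B * \<bar>x - x'\<bar> powr \<alpha>"
    using assms by (auto simp: holder_on_iff[OF is_norm_norm])
  have "(u \<longlongrightarrow> u x) (at x within I)" if "x \<in> I" for x
  proof (rule LIM_zero_cancel, rule Lim_null_comparison)
    show "\<forall>\<^sub>F y in at x within I. norm (u y - u x) \<le> B * \<bar>y - x\<bar> powr \<alpha>"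
      using B that by (auto simp: eventually_at_filter)
    have "((\<lambda>y. \<bar>y - x\<bar> powr \<alpha>) \<longlongrightarrow> \<bar>x - x\<bar> powr \<alpha>) (at x within I)"
      using assms(2) by (intro tendsto_powr2 tendsto_intros) auto
    then show "((\<lambda>y. B * \<bar>y - x\<bar> powr \<alpha>) \<longlongrightarrow> 0) (at x within I)"
      using tendsto_mult_right_zero by fastforce
  qed
  then show ?thesis by (simp add: continuous_on_def)
qed

text \<open>On a bounded set, a Lipschitz estimate implies a Hoelder estimate.\<close>

lemma le_powr_mult_powr:
  fixes t D \<alpha> :: real
  assumes "0 \<le> t" "t \<le> D" "\<alpha> \<le> 1"
  shows "t \<le> D powr (1 - \<alpha>) * t powr \<alpha>"
proof (cases "t = 0")
  case False
  then have "t = t powr (1 - \<alpha>) * t powr \<alpha>" using assms by (simp flip: powr_add)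
  also have "\<dots> \<le> D powr (1 - \<alpha>) * t powr \<alpha>"
    using assms by (intro mult_right_mono powr_mono2) auto
  finally show ?thesis .
qed simp

section \<open>The Urysohn convolution in the difference variable\<close>

text \<open>The indicator extends the integrand by zero to the whole line. Integrals over the moving
  interval \<open>[x - b, x - a]\<close> thereby become integrals over a fixed space, so that they can be
  subtracted pointwise for different \<open>x\<close> and transformed by an affine substitution.\<close>

definition diff_integrand ::
  "real \<Rightarrow> real \<Rightarrow> (real \<Rightarrow> 'v \<Rightarrow> 'w::real_vector) \<Rightarrow> (real \<Rightarrow> 'v) \<Rightarrow> real \<Rightarrow> real \<Rightarrow> 'w" where
  "diff_integrand a b f u x s = indicator {x - b..x - a} s *\<^sub>R f s (u (x - s))"

text \<open>Continuity on either side of the singularity gives Borel rather than only Lebesgue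
  measurability. This is what permits the substitution \<open>s = x - y\<close> below to be carried out for
  Borel measure.\<close>

lemma diff_integrand_borel_measurable:
  fixes f :: "real \<Rightarrow> 'v::topological_space \<Rightarrow> 'w::euclidean_space"
  assumes x: "x \<in> {a..b}" and u: "continuous_on {a..b} u" "u ` {a..b} \<subseteq> Z"
    and neg: "continuous_on ({a - b..<0} \<times> Z) (\<lambda>(y, z). f y z)"
    and pos: "continuous_on ({0<..b - a} \<times> Z) (\<lambda>(y, z). f y z)"
  shows "diff_integrand a b f u x \<in> borel_measurable borel"
proof -
  let ?g = "\<lambda>s. f s (u (x - s))"
  have cont: "continuous_on J ?g"
    if "J \<subseteq> S" "J \<subseteq> {x - b..x - a}" "continuous_on (S \<times> Z) (\<lambda>(y, z). f y z)" for J S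
  proof -
    have "continuous_on J (\<lambda>s. (s, u (x - s)))"
      using that(2) by (intro continuous_intros continuous_on_compose2[OF u(1)]) auto
    moreover have "(\<lambda>s. (s, u (x - s))) ` J \<subseteq> S \<times> Z"
      using that u(2) by force
    ultimately show ?thesis
      using continuous_on_compose2[OF that(3), of J "\<lambda>s. (s, u (x - s))"] by simp
  qed
  have "(\<lambda>s. indicator {x - b..<0} s *\<^sub>R ?g s) \<in> borel_measurable borel"
    using x by (intro borel_measurable_continuous_on_indicator cont[OF _ _ neg]) auto
  moreover have "(\<lambda>s. indicator {0<..x - a} s *\<^sub>R ?g s) \<in> borel_measurable borel"
    using x by (intro borel_measurable_continuous_on_indicator cont[OF _ _ pos]) auto
  moreover have "(\<lambda>s. indicator {0::real} s *\<^sub>R ?g 0) \<in> borel_measurable borel"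
    by measurable
  ultimately have "(\<lambda>s. indicator {x - b..<0} s *\<^sub>R ?g s + indicator {0<..x - a} s *\<^sub>R ?g s
      + indicator {0} s *\<^sub>R ?g 0) \<in> borel_measurable borel"
    by (intro borel_measurable_add)
  also have "(\<lambda>s. indicator {x - b..<0} s *\<^sub>R ?g s + indicator {0<..x - a} s *\<^sub>R ?g s
      + indicator {0} s *\<^sub>R ?g 0) = diff_integrand a b f u x"
    using x by (auto simp: diff_integrand_def fun_eq_iff indicator_def)
  finally show ?thesis .
qed

lemma AE_lebesgue_on_Icc:
  "(AE s in lebesgue_on {p..q::real}. P s) \<longleftrightarrow> (AE s in lebesgue. s \<in> {p..q} \<longrightarrow> P s)"
  by (simp add: AE_restrict_space_iff)

lemma diff_integrand_integrable:
  fixes f :: "real \<Rightarrow> 'v::topological_space \<Rightarrow> 'w::euclidean_space"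
  assumes x: "x \<in> {a..b}" and meas: "diff_integrand a b f u x \<in> borel_measurable borel"
    and \<beta>: "integrable (lebesgue_on {a - b..b - a}) \<beta>"
    and bound: "AE s in lebesgue_on {a - b..b - a}. \<forall>z\<in>u ` {a..b}. norm (f s z) \<le> \<beta> s"
  shows "integrable lborel (diff_integrand a b f u x)"
proof -
  have "integrable lebesgue (\<lambda>s. indicator {a - b..b - a} s *\<^sub>R \<beta> s)"
    using \<beta> by (simp add: integrable_restrict_space)
  moreover have "diff_integrand a b f u x \<in> borel_measurable lebesgue"
    using meas by (intro measurable_completion) simp
  moreover have "AE s in lebesgue.
      norm (diff_integrand a b f u x s) \<le> norm (indicator {a - b..b - a} s *\<^sub>R \<beta> s)"
    using bound unfolding AE_lebesgue_on_Icc
  proof eventually_elim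
    case (elim s)
    show ?case
    proof (cases "s \<in> {x - b..x - a}")
      case True
      then have "s \<in> {a - b..b - a}" "x - s \<in> {a..b}" using x by auto
      then show ?thesis using True elim by (force simp: diff_integrand_def)
    qed (simp add: diff_integrand_def)
  qed
  ultimately have "integrable lebesgue (diff_integrand a b f u x)"
    by (rule Bochner_Integration.integrable_bound)
  then show ?thesis using meas by (simp add: integrable_completion)
qed

lemma conv_urysohn_eq_integral_diff:
  fixes f :: "real \<Rightarrow> 'v::topological_space \<Rightarrow> 'w::euclidean_space"
  assumes int: "integrable lborel (diff_integrand a b f u x)"
  shows "integrable (lebesgue_on {a..b}) (\<lambda>y. f (x - y) (u y))"
    and "conv_urysohn a b f u x = (\<integral>s. diff_integrand a b f u x s \<partial>lborel)"
proof -
  have flip: "(\<lambda>y. diff_integrand a b f u x (x + (- 1) * y)) =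
      (\<lambda>y. indicator {a..b} y *\<^sub>R f (x - y) (u y))"
    by (auto simp: diff_integrand_def indicator_def fun_eq_iff)
  have int': "integrable lborel (\<lambda>y. indicator {a..b} y *\<^sub>R f (x - y) (u y))"
    using lborel_integrable_real_affine[OF int, of "- 1" x] unfolding flip by simp
  have meas: "(\<lambda>y. indicator {a..b} y *\<^sub>R f (x - y) (u y)) \<in> borel_measurable lborel"
    using int' by (rule borel_measurable_integrable)
  show "integrable (lebesgue_on {a..b}) (\<lambda>y. f (x - y) (u y))"
    using int' meas by (simp add: integrable_restrict_space integrable_completion)
  have "conv_urysohn a b f u x = (\<integral>y. indicator {a..b} y *\<^sub>R f (x - y) (u y) \<partial>lborel)"
    using meas by (simp add: conv_urysohn_def integral_restrict_space integral_completion)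
  also have "\<dots> = (\<integral>s. diff_integrand a b f u x s \<partial>lborel)"
    using lborel_integral_real_affine[of "- 1" "diff_integrand a b f u x" x] unfolding flip by simp
  finally show "conv_urysohn a b f u x = (\<integral>s. diff_integrand a b f u x s \<partial>lborel)" .
qed

section \<open>Hoelder continuity\<close>

text \<open>The bound is the sum of the contribution of the common part of the two
  integration intervals and of the two edges, on which only one of the integrands lives and
  \<open>s\<close> stays away from \<open>0\<close>.\<close>

lemma conv_urysohn_increment:
  fixes f :: "real \<Rightarrow> 'v::real_normed_vector \<Rightarrow> 'w::euclidean_space"
  assumes xx': "c \<le> x" "x < x'" "x' \<le> d" and cd: "a < c" "d < b" and "0 \<le> M" "0 \<le> B"
    and int: "\<And>x. x \<in> {a..b} \<Longrightarrow> integrable lborel (diff_integrand a b f u x)"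
    and u: "\<And>x x'. x \<in> {a..b} \<Longrightarrow> x' \<in> {a..b} \<Longrightarrow> norm (u x - u x') \<le> B * \<bar>x - x'\<bar> powr \<alpha>"
    and L: "integrable (lebesgue_on {a - b..b - a}) L" "\<And>s. s \<in> {a - b..b - a} \<Longrightarrow> 0 \<le> L s"
    and lip: "AE s in lebesgue_on {a - b..b - a}. \<forall>z\<in>u ` {a..b}. \<forall>z'\<in>u ` {a..b}.
      norm (f s z - f s z') \<le> L s * norm (z - z')"
    and M: "\<And>s z. s \<in> {a - b..d - b} \<union> {c - a..b - a} \<Longrightarrow> z \<in> u ` {a..b} \<Longrightarrow> norm (f s z) \<le> M"
  shows "norm (conv_urysohn a b f u x' - conv_urysohn a b f u x)
    \<le> B * integral\<^sup>L (lebesgue_on {a - b..b - a}) L * \<bar>x' - x\<bar> powr \<alpha> + 2 * M * \<bar>x' - x\<bar>"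
proof -
  let ?G = "diff_integrand a b f u"
  let ?K = "B * \<bar>x' - x\<bar> powr \<alpha>"
  have mem: "x \<in> {a..b}" "x' \<in> {a..b}" using xx' cd by auto
  \<comment> \<open>The integrable majorant: its first summand serves the common part, its second the edges.\<close>
  define w where "w s = ?K * (indicator {a - b..b - a} s * L s)
      + M * (indicator {x - a..x' - a} s + indicator {x - b..x' - b} s)" for s
  have intL: "integrable lebesgue (\<lambda>s. indicator {a - b..b - a} s * L s)"
    using L(1) by (simp add: integrable_restrict_space)
  have intI: "integrable lebesgue (\<lambda>s. indicator {p..q} s :: real)" for p q :: real
    by (rule integrable_real_indicator) (auto simp: emeasure_lborel_Icc_eq)
  have intw: "integrable lebesgue w"
    unfolding w_def
    by (intro Bochner_Integration.integrable_add integrable_mult_right intL intI)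
  have intG: "integrable lebesgue (\<lambda>s. ?G x' s - ?G x s)"
    using int[OF mem(1)] int[OF mem(2)]
    by (intro Bochner_Integration.integrable_diff) (simp_all add: integrable_completion)
  have bound: "AE s in lebesgue. norm (?G x' s - ?G x s) \<le> w s"
    using lip unfolding AE_lebesgue_on_Icc
  proof eventually_elim
    case (elim s)
    have edges: "0 \<le> M * (indicator {x - a..x' - a} s + indicator {x - b..x' - b} s)"
      using \<open>0 \<le> M\<close> by simp
    have core: "0 \<le> ?K * (indicator {a - b..b - a} s * L s)"
      using L(2)[of s] \<open>0 \<le> B\<close> by (auto simp: indicator_def)
    consider (both) "s \<in> {x - b..x - a}" "s \<in> {x' - b..x' - a}"
      | (right) "s \<notin> {x - b..x - a}" "s \<in> {x' - b..x' - a}"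
      | (left) "s \<in> {x - b..x - a}" "s \<notin> {x' - b..x' - a}"
      | (none) "s \<notin> {x - b..x - a}" "s \<notin> {x' - b..x' - a}" by blast
    then show ?case
    proof cases
      case both
      have s: "s \<in> {a - b..b - a}" "x - s \<in> {a..b}" "x' - s \<in> {a..b}" using both mem by auto
      have "norm (?G x' s - ?G x s) = norm (f s (u (x' - s)) - f s (u (x - s)))"
        using both by (simp add: diff_integrand_def)
      also have "\<dots> \<le> L s * norm (u (x' - s) - u (x - s))" using elim s by blast
      also have "\<dots> \<le> L s * ?K"
        using u[OF s(3) s(2)] L(2)[OF s(1)] by (intro mult_left_mono) auto
      also have "\<dots> = ?K * (indicator {a - b..b - a} s * L s)" using s(1) by simp
      finally show ?thesis using edges by (simp add: w_def)
    next
      case right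
      then have s: "s \<in> {x - a..x' - a}" "s \<in> {c - a..b - a}" "x' - s \<in> {a..b}"
        using xx' cd by auto
      have "norm (?G x' s - ?G x s) = norm (f s (u (x' - s)))"
        using right by (simp add: diff_integrand_def)
      also have "\<dots> \<le> M" using s by (intro M) auto
      also have "\<dots> \<le> M * (indicator {x - a..x' - a} s + indicator {x - b..x' - b} s)"
        using s(1) \<open>0 \<le> M\<close> by (simp add: mult_le_cancel_left1)
      finally show ?thesis using core by (simp add: w_def)
    next
      case left
      then have s: "s \<in> {x - b..x' - b}" "s \<in> {a - b..d - b}" "x - s \<in> {a..b}"
        using xx' cd by auto
      have "norm (?G x' s - ?G x s) = norm (f s (u (x - s)))"
        using left by (simp add: diff_integrand_def)
      also have "\<dots> \<le> M" using s by (intro M) auto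
      also have "\<dots> \<le> M * (indicator {x - a..x' - a} s + indicator {x - b..x' - b} s)"
        using s(1) \<open>0 \<le> M\<close> by (simp add: mult_le_cancel_left1)
      finally show ?thesis using core by (simp add: w_def)
    next
      case none
      then show ?thesis using core edges by (simp add: w_def diff_integrand_def)
    qed
  qed
  have "conv_urysohn a b f u x' - conv_urysohn a b f u x = (\<integral>s. ?G x' s - ?G x s \<partial>lebesgue)"
    using int[OF mem(1)] int[OF mem(2)]
    by (simp add: conv_urysohn_eq_integral_diff integral_completion)
  then have "norm (conv_urysohn a b f u x' - conv_urysohn a b f u x)
      \<le> (\<integral>s. norm (?G x' s - ?G x s) \<partial>lebesgue)"
    by simp
  also have "\<dots> \<le> (\<integral>s. w s \<partial>lebesgue)"
    using bound intG intw by (intro integral_mono_AE integrable_norm)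
  also have "\<dots> = ?K * (\<integral>s. indicator {a - b..b - a} s * L s \<partial>lebesgue)
      + M * ((x' - x) + (x' - x))"
    unfolding w_def using xx' intL intI
    by simp
  also have "(\<integral>s. indicator {a - b..b - a} s * L s \<partial>lebesgue)
      = integral\<^sup>L (lebesgue_on {a - b..b - a}) L"
    by (simp add: integral_restrict_space)
  finally show ?thesis using xx' by (simp add: algebra_simps)
qed

text \<open>Since \<open>u\<close> has compact range and \<open>f\<close> is continuous away from \<open>s = 0\<close>, there is a constant
  \<open>M\<close> as \<open>conv_urysohn_increment\<close> requires, uniform in \<open>x\<close> and \<open>x'\<close>.\<close>

lemma conv_urysohn_holder_on:
  fixes f :: "real \<Rightarrow> 'v::real_normed_vector \<Rightarrow> 'w::euclidean_space"
  assumes \<alpha>: "0 < \<alpha>" "\<alpha> \<le> 1" and cd: "a < c" "c \<le> d" "d < b"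
    and u: "holder_on norm \<alpha> {a..b} u" "u ` {a..b} \<subseteq> Z"
    and int: "\<And>x. x \<in> {a..b} \<Longrightarrow> integrable lborel (diff_integrand a b f u x)"
    and neg: "continuous_on ({a - b..<0} \<times> Z) (\<lambda>(y, z). f y z)"
    and pos: "continuous_on ({0<..b - a} \<times> Z) (\<lambda>(y, z). f y z)"
    and L: "integrable (lebesgue_on {a - b..b - a}) L" "\<And>s. s \<in> {a - b..b - a} \<Longrightarrow> 0 \<le> L s"
    and lip: "AE s in lebesgue_on {a - b..b - a}. \<forall>z\<in>u ` {a..b}. \<forall>z'\<in>u ` {a..b}.
      norm (f s z - f s z') \<le> L s * norm (z - z')"
  shows "holder_on norm \<alpha> {c..d} (conv_urysohn a b f u)"
proof -
  let ?F = "conv_urysohn a b f u"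
  let ?S = "{a - b..d - b} \<union> {c - a..b - a}"
  obtain B where B: "0 \<le> B"
    "\<And>x x'. x \<in> {a..b} \<Longrightarrow> x' \<in> {a..b} \<Longrightarrow> norm (u x - u x') \<le> B * \<bar>x - x'\<bar> powr \<alpha>"
    using u(1) \<alpha>(1) by (auto simp: holder_on_iff[OF is_norm_norm])
  have compact: "compact (u ` {a..b})"
    using holder_on_imp_continuous_on[OF u(1) \<alpha>(1)] by (intro compact_continuous_image) auto
  have "continuous_on ({a - b..d - b} \<times> u ` {a..b}) (\<lambda>(y, z). f y z)"
    using cd u(2) by (intro continuous_on_subset[OF neg]) auto
  moreover have "continuous_on ({c - a..b - a} \<times> u ` {a..b}) (\<lambda>(y, z). f y z)"
    using cd u(2) by (intro continuous_on_subset[OF pos]) auto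
  ultimately have "compact ((\<lambda>(y, z). f y z) ` ({a - b..d - b} \<times> u ` {a..b}) \<union>
      (\<lambda>(y, z). f y z) ` ({c - a..b - a} \<times> u ` {a..b}))"
    by (intro compact_Un compact_continuous_image compact_Times compact_Icc compact)
  then obtain M where "0 < M" and M': "\<And>v. v \<in> (\<lambda>(y, z). f y z) ` ({a - b..d - b} \<times> u ` {a..b}) \<union>
      (\<lambda>(y, z). f y z) ` ({c - a..b - a} \<times> u ` {a..b}) \<Longrightarrow> norm v \<le> M"
    using compact_imp_bounded bounded_pos by metis
  have M: "norm (f s z) \<le> M" if "s \<in> ?S" "z \<in> u ` {a..b}" for s z
    using that by (intro M') force
  let ?\<Lambda> = "integral\<^sup>L (lebesgue_on {a - b..b - a}) L"
  let ?C = "B * ?\<Lambda> + 2 * M * (d - c) powr (1 - \<alpha>)"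
  have ordered: "norm (?F x' - ?F x) \<le> ?C * \<bar>x' - x\<bar> powr \<alpha>"
    if "x \<in> {c..d}" "x' \<in> {c..d}" "x < x'" for x x'
  proof -
    have "norm (?F x' - ?F x) \<le> B * ?\<Lambda> * \<bar>x' - x\<bar> powr \<alpha> + 2 * M * \<bar>x' - x\<bar>"
      using that cd \<open>0 < M\<close> by (intro conv_urysohn_increment[OF _ _ _ _ _ _ B(1) int B(2) L lip M]) auto
    also have "\<dots> \<le> B * ?\<Lambda> * \<bar>x' - x\<bar> powr \<alpha>
        + 2 * M * ((d - c) powr (1 - \<alpha>) * \<bar>x' - x\<bar> powr \<alpha>)"
      using that \<alpha> \<open>0 < M\<close> by (intro add_left_mono mult_left_mono le_powr_mult_powr) auto
    finally show ?thesis by (simp add: algebra_simps)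
  qed
  have "norm (?F x - ?F x') \<le> ?C * \<bar>x - x'\<bar> powr \<alpha>"
    if "x \<in> {c..d}" "x' \<in> {c..d}" for x x'
    using ordered[of x x'] ordered[of x' x] that
    by (cases x x' rule: linorder_cases) (auto simp: norm_minus_commute abs_minus_commute)
  moreover have "0 \<le> ?C"
    using B(1) \<open>0 < M\<close> L(2) by (intro add_nonneg_nonneg mult_nonneg_nonneg Bochner_Integration.integral_nonneg) auto
  ultimately show ?thesis
    using \<alpha>(1) by (auto simp: holder_on_iff[OF is_norm_norm])
qed

theorem theorem2p14:
  fixes a b \<alpha> r :: real
    and Z :: "(real ^ 'n) set"
    and f :: "real \<Rightarrow> real ^ 'n \<Rightarrow> real ^ 'd"
    and normn :: "real ^ 'n \<Rightarrow> real"
    and normd :: "real ^ 'd \<Rightarrow> real"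
    and l :: "real \<Rightarrow> real \<Rightarrow> real"
    and u :: "real \<Rightarrow> real ^ 'n"
  assumes "a < b" and "Z \<noteq> {}" and "is_norm normn" and "is_norm normd"
    and "0 < \<alpha>" and "\<alpha> \<le> 1"
    and a_meas: "\<And>z. z \<in> Z \<Longrightarrow> (\<lambda>y. f y z) \<in> borel_measurable (lebesgue_on {a - b..b - a})"
    and a_bound: "\<And>r. 0 < r \<Longrightarrow> \<exists>\<beta> :: real \<Rightarrow> real.
        integrable (lebesgue_on {a - b..b - a}) \<beta> \<and> (\<forall>y\<in>{a - b..b - a}. 0 \<le> \<beta> y) \<and>
        (AE y in lebesgue_on {a - b..b - a}. \<forall>z \<in> Z \<inter> norm_cball normn r. normd (f y z) \<le> \<beta> y)"
    and b_lip: "\<And>r. 0 < r \<Longrightarrow>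
        integrable (lebesgue_on {a - b..b - a}) (l r) \<and> (\<forall>y\<in>{a - b..b - a}. 0 \<le> l r y) \<and>
        (AE y in lebesgue_on {a - b..b - a}.
           \<forall>z \<in> Z \<inter> norm_cball normn r. \<forall>z' \<in> Z \<inter> norm_cball normn r.
             normd (f y z - f y z') \<le> l r y * normn (z - z'))"
    and c_neg: "C1_fst_on {a - b..<0} Z f"
    and c_pos: "C1_fst_on {0<..b - a} Z f"
    and u: "u \<in> holder_class normn \<alpha> a b Z"
    and r: "sup_norm normn a b u < r"
    and h0: "\<exists>h0>0. h0 \<le> b - a \<and> (\<integral>\<^sup>+y\<in>{- h0..h0}. ennreal (l r y) \<partial>lebesgue) < \<infinity>"
  shows "(\<forall>x\<in>{a..b}. integrable (lebesgue_on {a..b}) (\<lambda>y. f (x - y) (u y))) \<and>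
         (\<forall>c d. c \<le> d \<longrightarrow> {c..d} \<subseteq> {a<..<b} \<longrightarrow> holder_on normd \<alpha> {c..d} (conv_urysohn a b f u))"
proof -
  obtain Cd where Cd: "0 < Cd" "\<And>v. norm v \<le> Cd * normd v"
    using norm_le_is_norm[OF \<open>is_norm normd\<close>] by metis
  obtain Cn where Cn: "0 < Cn" "\<And>v. normn v \<le> Cn * norm v"
    using is_norm_le_norm[OF \<open>is_norm normn\<close>] by metis
  have uZ: "u ` {a..b} \<subseteq> Z" and hol: "holder_on norm \<alpha> {a..b} u"
    using u holder_on_norm_cong[OF \<open>is_norm normn\<close> \<open>0 < \<alpha>\<close>] by (auto simp: holder_class_def)
  note cont = holder_on_imp_continuous_on[OF hol \<open>0 < \<alpha>\<close>]
  have neg: "continuous_on ({a - b..<0} \<times> Z) (\<lambda>(y, z). f y z)"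
    and pos: "continuous_on ({0<..b - a} \<times> Z) (\<lambda>(y, z). f y z)"
    using c_neg c_pos by (simp_all add: C1_fst_on_def)
  have "compact ((\<lambda>x. normn (u x)) ` {a..b})"
    by (intro compact_continuous_image compact_Icc
        continuous_on_compose2[OF is_norm_continuous_on[OF \<open>is_norm normn\<close>, of UNIV] cont]) simp
  then have bdd: "bdd_above ((\<lambda>x. normn (u x)) ` {a..b})"
    by (intro bounded_imp_bdd_above compact_imp_bounded)
  have le_r: "normn (u x) < r" if "x \<in> {a..b}" for x
    using cSUP_upper[OF that bdd] r by (simp add: sup_norm_def)
  have "0 < r"
    using le_r[of a] \<open>a < b\<close> \<open>is_norm normn\<close> by (smt (verit) atLeastAtMost_iff is_norm_def)
  have range: "u ` {a..b} \<subseteq> Z \<inter> norm_cball normn r"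
    using uZ le_r by (force simp: norm_cball_def)
  obtain \<beta> where \<beta>: "integrable (lebesgue_on {a - b..b - a}) \<beta>"
    "AE y in lebesgue_on {a - b..b - a}. \<forall>z \<in> Z \<inter> norm_cball normn r. normd (f y z) \<le> \<beta> y"
    using a_bound[OF \<open>0 < r\<close>] by blast
  have bound: "AE s in lebesgue_on {a - b..b - a}. \<forall>z\<in>u ` {a..b}. norm (f s z) \<le> Cd * \<beta> s"
    using \<beta>(2)
  proof eventually_elim
    case (elim s)
    show ?case
    proof
      fix z assume "z \<in> u ` {a..b}"
      then have "normd (f s z) \<le> \<beta> s" using elim range by blast
      then show "norm (f s z) \<le> Cd * \<beta> s"
        using Cd by (meson less_imp_le mult_left_mono order_trans)
    qed
  qed
  have lip: "AE s in lebesgue_on {a - b..b - a}. \<forall>z\<in>u ` {a..b}. \<forall>z'\<in>u ` {a..b}.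
      norm (f s z - f s z') \<le> (Cd * Cn * l r s) * norm (z - z')"
    using conjunct2[OF conjunct2[OF b_lip[OF \<open>0 < r\<close>]]] AE_space
  proof eventually_elim
    case (elim s)
    then have l0: "0 \<le> l r s" using b_lip[OF \<open>0 < r\<close>] by simp
    show ?case
    proof (intro ballI)
      fix z z' assume "z \<in> u ` {a..b}" "z' \<in> u ` {a..b}"
      then have "normd (f s z - f s z') \<le> l r s * normn (z - z')" using elim(1) range by blast
      also have "\<dots> \<le> l r s * (Cn * norm (z - z'))" using Cn(2) l0 by (rule mult_left_mono)
      finally have "Cd * normd (f s z - f s z') \<le> Cd * (l r s * (Cn * norm (z - z')))"
        using Cd(1) by (intro mult_left_mono) auto
      then show "norm (f s z - f s z') \<le> (Cd * Cn * l r s) * norm (z - z')"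
        using Cd(2)[of "f s z - f s z'"] by (simp add: mult_ac)
    qed
  qed
  have int: "integrable lborel (diff_integrand a b f u x)" if "x \<in> {a..b}" for x
    using that bound \<beta>(1)
    by (intro diff_integrand_integrable[where \<beta> = "\<lambda>s. Cd * \<beta> s"]
        diff_integrand_borel_measurable[OF that cont uZ neg pos]) auto
  have "holder_on normd \<alpha> {c..d} (conv_urysohn a b f u)"
    if "c \<le> d" "{c..d} \<subseteq> {a<..<b}" for c d
    unfolding holder_on_norm_cong[OF \<open>is_norm normd\<close> \<open>0 < \<alpha>\<close>]
  proof (rule conv_urysohn_holder_on[OF \<open>0 < \<alpha>\<close> \<open>\<alpha> \<le> 1\<close> _ that(1) _ hol uZ int neg pos _ _ lip])
    show "a < c" "d < b" using that by auto
    show "integrable (lebesgue_on {a - b..b - a}) (\<lambda>s. Cd * Cn * l r s)"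
      using b_lip[OF \<open>0 < r\<close>] by auto
    show "0 \<le> Cd * Cn * l r s" if "s \<in> {a - b..b - a}" for s
      using b_lip[OF \<open>0 < r\<close>] that Cd(1) Cn(1) by auto
  qed
  then show ?thesis using conv_urysohn_eq_integral_diff(1)[OF int] by blast
qed

end
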